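(* Consider an instance of the semi-infinite convex program (SICP) satisfying Assumptions 1 and 2 (both stated in the context), and an execution of the central cutting surface algorithm described in the context on this instance. Suppose that the algorithm terminates in the $k$th iteration. Then $y^{(k-1)}$ is an $\varepsilon$-optimal solution to (SICP).
   Context: **Problem (SICP).** Minimize $x_0$ subject to $g(x,t)\le 0$ for all $t\in T$ and $x\in X$, where $X\subseteq\mathbb{R}^n$, $x_0$ denotes the first coordinate of $x\in\mathbb{R}^n$, $T$ is an index set (not required to be convex or finite dimensional), and $g\colon X\times T\to\mathbb{R}$. **Assumption 1.** (1) The set $X$ is convex, closed and bounded. (2) There exist a Slater point $\bar x$ and $\eta>0$ satisfying $\bar x\in X$ and $g(\bar x,t)\le-\eta$ for every $t\in T$. (3) The function $g(\cdot,t)$ is convex and subdifferentiable for every $t\in T$; moreover, these subdifferentials are uniformly bounded: there exists $B>0$ such that for every $x\in X$ and $t\in T$, every subgradient $d\in\partial_x g(x,t)$ (the subdifferential of $g(\cdot,t)$ at $x$) satisfies $\|d\|\le B$. **Optimality notions.** Let $\varepsilon\ge0$. A point $x\in X$ is $\varepsilon$-feasible if $g(x,t)\le\varepsilon$ for every $t\in T$. Let $x^*$ be an optimal solution of (SICP) (the minimum is attained), so $x_0^*$ is the optimal value. A point of $X$ is an $\varepsilon$-optimal solution to (SICP) if it is $\varepsilon$-feasible and its first coordinate is at most $x_0^*$. **Assumption 2 (with tolerance $\varepsilon$).** For every point $x\in X$ that is not $\varepsilon$-feasible, we can find in finite time a $t\in T$ satisfying $g(x,t)>0$. (For $\varepsilon$-feasible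 $x$ the search may either find some $t\in T$ with $g(x,t)>0$ or find none.) **Central cutting surface algorithm.** Parameters: a strict upper bound $U$ on the optimal value of (SICP); $B>0$ for which Assumption 1 holds; $\varepsilon\ge0$ for which Assumption 2 holds; an arbitrary $\beta>1$ ($\beta=\infty$, meaning no cuts are dropped, is allowed). - Step 1. Set $k=1$, $y^{(0)}=(U,0,\dots,0)\in\mathbb{R}^n$, $J^{(0)}=\emptyset$. - Step 2. Determine the optimal solution $(x^{(k)},\sigma^{(k)})$ of the master problem: maximize $\sigma$ over $(x,\sigma)$ subject to $x_0+\sigma\le y_0^{(k-1)}$; $g(x,t^{(j)})+\sigma s^{(j)}\le0$ for all $j\in J^{(k-1)}$; $x\in X$. - Step 3. If $\sigma^{(k)}=0$, stop and return $y^{(k-1)}$. - Step 4. Find a $t^{(k)}\in T$ satisfying $g(x^{(k)},t^{(k)})>0$ if possible (in the sense of Assumption 2). If no such $t^{(k)}$ is found, go to Step 6. - Step 5 (feasibility cut). Set $J^{(k)}=J^{(k-1)}\cup\{k\}$, $y^{(k)}=y^{(k-1)}$, and choose a centering parameter $s^{(k)}$. Go to Step 7. - Step 6 (optimality cut). Set $J^{(k)}=J^{(k-1)}$, $y^{(k)}=x^{(k)}$. - Step 7 (drop cuts). Let $D=\{j\in J^{(k)} : \sigma^{(j)}\ge\beta\sigma^{(k)}\text{ and } g(x^{(k)},t^{(j)})+\sigma^{(k)}s^{(j)}<0\}$ and replace $J^{(k)}$ by $J^{(k)}\setminus D$. - Step 8. Increase $k$ by one and go to Step 2. **Centering parameters.**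 They are chosen by one of two strategies: (i) $s_{\min}\le s^{(k)}\le B$ for every $k$, with some $s_{\min}>0$; or (ii) $s^{(k)}=\alpha\|d\|$ with a subgradient $d\in\partial_x g(x^{(k)},t^{(k)})$ and an arbitrary $\alpha\in(0,1]$. *)

theory Defs
  imports "HOL-Analysis.Analysis"
begin

text \<open>
  The decision vector lives in \<open>real ^ 'n\<close>; the distinguished index \<open>o1 :: 'n\<close> names the
  first coordinate, i.e. the objective is \<open>x $ o1\<close>.  The constraint function is a total function
  \<open>g\<close> whose values matter only on \<open>E\<close> and \<open>T\<close>, where \<open>E \<supseteq> X\<close> is
  the set on which the functions \<open>g(., t)\<close> are regarded as defined.
\<close>

definition subdifferential :: "'a::real_inner set \<Rightarrow> ('a \<Rightarrow> real) \<Rightarrow> 'a \<Rightarrow> 'a set"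
  where "subdifferential E f x = {d. \<forall>z\<in>E. f x + d \<bullet> (z - x) \<le> f z}"

text \<open>
  Subgradients are taken relative to \<open>E\<close> rather than \<open>X\<close>: the set \<open>X\<close> is compact, and
  at a boundary point of \<open>X\<close> a nonempty subdifferential relative to \<open>X\<close> itself is unbounded,
  because it is closed under adding elements of the normal cone.
  The choices \<open>E = X\<close> and \<open>E = UNIV\<close> are both included.
\<close>

definition assumption1 ::
  "(real ^ 'n) set \<Rightarrow> (real ^ 'n) set \<Rightarrow> 't set \<Rightarrow> (real ^ 'n \<Rightarrow> 't \<Rightarrow> real) \<Rightarrow> real \<Rightarrow> bool"
  where "assumption1 E X T g B \<longleftrightarrow>
    convex X \<and> closed X \<and> bounded X \<and>
    (\<exists>xbar\<in>X. \<exists>\<eta>>0. \<forall>t\<in>T. g xbar t \<le> - \<eta>) \<and>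
    X \<subseteq> E \<and>
    (\<forall>t\<in>T. convex_on E (\<lambda>x. g x t)) \<and>
    (\<forall>t\<in>T. \<forall>x\<in>X. subdifferential E (\<lambda>z. g z t) x \<noteq> {}) \<and>
    B > 0 \<and>
    (\<forall>x\<in>X. \<forall>t\<in>T. \<forall>d\<in>subdifferential E (\<lambda>z. g z t) x. norm d \<le> B)"

definition eps_feasible ::
  "(real ^ 'n) set \<Rightarrow> 't set \<Rightarrow> (real ^ 'n \<Rightarrow> 't \<Rightarrow> real) \<Rightarrow> real \<Rightarrow> real ^ 'n \<Rightarrow> bool"
  where "eps_feasible X T g \<epsilon> x \<longleftrightarrow> x \<in> X \<and> (\<forall>t\<in>T. g x t \<le> \<epsilon>)"

definition sicp_optimal ::
  "'n \<Rightarrow> (real ^ 'n) set \<Rightarrow> 't set \<Rightarrow> (real ^ 'n \<Rightarrow> 't \<Rightarrow> real) \<Rightarrow> real ^ 'n \<Rightarrow> bool"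
  where "sicp_optimal o1 X T g x \<longleftrightarrow>
    is_arg_min (\<lambda>x. x $ o1) (\<lambda>x. x \<in> X \<and> (\<forall>t\<in>T. g x t \<le> 0)) x"

definition eps_optimal ::
  "'n \<Rightarrow> (real ^ 'n) set \<Rightarrow> 't set \<Rightarrow> (real ^ 'n \<Rightarrow> 't \<Rightarrow> real) \<Rightarrow> real \<Rightarrow> real ^ 'n \<Rightarrow> real ^ 'n \<Rightarrow> bool"
  where "eps_optimal o1 X T g \<epsilon> xopt x \<longleftrightarrow> eps_feasible X T g \<epsilon> x \<and> x $ o1 \<le> xopt $ o1"

text \<open>
  The search for a violated constraint is a nondeterministic procedure: \<open>search x\<close> is the set of its
  possible results at \<open>x\<close>, where \<open>None\<close> means that no index was found.  Termination of the
  search is the nonemptiness of \<open>search x\<close>.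
\<close>

definition assumption2 ::
  "(real ^ 'n) set \<Rightarrow> 't set \<Rightarrow> (real ^ 'n \<Rightarrow> 't \<Rightarrow> real) \<Rightarrow> real \<Rightarrow> (real ^ 'n \<Rightarrow> 't option set) \<Rightarrow> bool"
  where "assumption2 X T g \<epsilon> search \<longleftrightarrow>
    (\<forall>x\<in>X. search x \<noteq> {} \<and>
      (\<forall>t. Some t \<in> search x \<longrightarrow> t \<in> T \<and> g x t > 0) \<and>
      (None \<in> search x \<longrightarrow> eps_feasible X T g \<epsilon> x))"

text \<open>The master problem with objective bound \<open>v\<close> and cuts \<open>(t j, s j)\<close> for \<open>j \<in> J\<close>.\<close>

definition master_optimal ::
  "'n \<Rightarrow> (real ^ 'n) set \<Rightarrow> (real ^ 'n \<Rightarrow> 't \<Rightarrow> real) \<Rightarrow> (nat \<Rightarrow> 't) \<Rightarrow> (nat \<Rightarrow> real) \<Rightarrow>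
    real \<Rightarrow> nat set \<Rightarrow> real ^ 'n \<Rightarrow> real \<Rightarrow> bool"
  where "master_optimal o1 X g t s v J x \<sigma> \<longleftrightarrow>
    is_arg_max snd
      (\<lambda>(z, \<tau>). z $ o1 + \<tau> \<le> v \<and> (\<forall>j\<in>J. g z (t j) + \<tau> * s j \<le> 0) \<and> z \<in> X) (x, \<sigma>)"

datatype centering = Interval real | Subgradient

definition valid_centering :: "centering \<Rightarrow> bool"
  where "valid_centering c \<longleftrightarrow> (\<forall>smin. c = Interval smin \<longrightarrow> smin > 0)"

fun centering_parameter ::
  "(real ^ 'n) set \<Rightarrow> (real ^ 'n \<Rightarrow> 't \<Rightarrow> real) \<Rightarrow> real \<Rightarrow> centering \<Rightarrow> real ^ 'n \<Rightarrow> 't \<Rightarrow> real \<Rightarrow> bool"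
  where
    "centering_parameter E g B (Interval smin) x t s \<longleftrightarrow> smin \<le> s \<and> s \<le> B"
  | "centering_parameter E g B Subgradient x t s \<longleftrightarrow>
      (\<exists>\<alpha>>0. \<alpha> \<le> 1 \<and> (\<exists>d\<in>subdifferential E (\<lambda>z. g z t) x. s = \<alpha> * norm d))"

text \<open>
  The explicit guard \<open>\<beta> \<noteq> \<infinity>\<close> makes \<open>\<beta> = \<infinity>\<close> mean that no cut is ever dropped;
  the product \<open>\<infinity> * \<sigma> k\<close> alone would not say this for \<open>\<sigma> k < 0\<close>.
\<close>

definition dropped_cuts ::
  "(real ^ 'n \<Rightarrow> 't \<Rightarrow> real) \<Rightarrow> ereal \<Rightarrow> (nat \<Rightarrow> real ^ 'n) \<Rightarrow> (nat \<Rightarrow> real) \<Rightarrow> (nat \<Rightarrow> 't) \<Rightarrow>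
    (nat \<Rightarrow> real) \<Rightarrow> nat \<Rightarrow> nat set \<Rightarrow> nat set"
  where "dropped_cuts g \<beta> x \<sigma> t s k J =
    {j \<in> J. \<beta> \<noteq> \<infinity> \<and> ereal (\<sigma> j) \<ge> \<beta> * ereal (\<sigma> k) \<and> g (x k) (t j) + \<sigma> k * s j < 0}"

text \<open>
  An execution is given by the sequences of its iterates.  The values \<open>t k\<close> and \<open>s k\<close> are
  meaningful only for iterations \<open>k\<close> in which a feasibility cut is added.
\<close>

definition feasibility_cut ::
  "(real ^ 'n) set \<Rightarrow> (real ^ 'n \<Rightarrow> 't \<Rightarrow> real) \<Rightarrow> real \<Rightarrow> (real ^ 'n \<Rightarrow> 't option set) \<Rightarrow> centering \<Rightarrow>
    ereal \<Rightarrow> (nat \<Rightarrow> real ^ 'n) \<Rightarrow> (nat \<Rightarrow> real) \<Rightarrow> (nat \<Rightarrow> real ^ 'n) \<Rightarrow> (nat \<Rightarrow> nat set) \<Rightarrow>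
    (nat \<Rightarrow> 't) \<Rightarrow> (nat \<Rightarrow> real) \<Rightarrow> nat \<Rightarrow> bool"
  where "feasibility_cut E g B search c \<beta> x \<sigma> y J t s k \<longleftrightarrow>
    Some (t k) \<in> search (x k) \<and>
    y k = y (k - 1) \<and>
    centering_parameter E g B c (x k) (t k) (s k) \<and>
    (let J' = J (k - 1) \<union> {k} in J k = J' - dropped_cuts g \<beta> x \<sigma> t s k J')"

definition optimality_cut ::
  "(real ^ 'n \<Rightarrow> 't \<Rightarrow> real) \<Rightarrow> (real ^ 'n \<Rightarrow> 't option set) \<Rightarrow>
    ereal \<Rightarrow> (nat \<Rightarrow> real ^ 'n) \<Rightarrow> (nat \<Rightarrow> real) \<Rightarrow> (nat \<Rightarrow> real ^ 'n) \<Rightarrow> (nat \<Rightarrow> nat set) \<Rightarrow>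
    (nat \<Rightarrow> 't) \<Rightarrow> (nat \<Rightarrow> real) \<Rightarrow> nat \<Rightarrow> bool"
  where "optimality_cut g search \<beta> x \<sigma> y J t s k \<longleftrightarrow>
    None \<in> search (x k) \<and>
    y k = x k \<and>
    (let J' = J (k - 1) in J k = J' - dropped_cuts g \<beta> x \<sigma> t s k J')"

text \<open>Execution of the central cutting surface algorithm that stops in iteration \<open>k\<close>.\<close>

definition terminates_in ::
  "'n \<Rightarrow> (real ^ 'n) set \<Rightarrow> (real ^ 'n) set \<Rightarrow> (real ^ 'n \<Rightarrow> 't \<Rightarrow> real) \<Rightarrow> real \<Rightarrow> real \<Rightarrow>
    (real ^ 'n \<Rightarrow> 't option set) \<Rightarrow> centering \<Rightarrow> ereal \<Rightarrow>
    (nat \<Rightarrow> real ^ 'n) \<Rightarrow> (nat \<Rightarrow> real) \<Rightarrow> (nat \<Rightarrow> real ^ 'n) \<Rightarrow> (nat \<Rightarrow> nat set) \<Rightarrow>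
    (nat \<Rightarrow> 't) \<Rightarrow> (nat \<Rightarrow> real) \<Rightarrow> nat \<Rightarrow> bool"
  where "terminates_in o1 E X g U B search c \<beta> x \<sigma> y J t s k \<longleftrightarrow>
    k \<ge> 1 \<and>
    y 0 = axis o1 U \<and> J 0 = {} \<and>
    (\<forall>i\<in>{1..k}. master_optimal o1 X g t s (y (i - 1) $ o1) (J (i - 1)) (x i) (\<sigma> i)) \<and>
    (\<forall>i\<in>{1..<k}. \<sigma> i \<noteq> 0 \<and>
      (feasibility_cut E g B search c \<beta> x \<sigma> y J t s i \<or>
       optimality_cut g search \<beta> x \<sigma> y J t s i)) \<and>
    \<sigma> k = 0"

end

theory Submission
  imports Defs
begin

text \<open>
  The stopping test certifies optimality because a Slater point rules out a zero master value
  above the optimum: if the objective bound \<open>v\<close> of the master problem exceeds the optimal value,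
  then moving from the optimal solution slightly towards the Slater point keeps the objective
  below \<open>v\<close> and makes every constraint strictly negative, uniformly over the index set.  Since
  all centering parameters are at most \<open>B\<close>, some positive \<open>\<tau>\<close> is then attainable
  (\<open>positive_master_value\<close>).  Hence \<open>\<sigma> k = 0\<close> forces the objective of \<open>y (k - 1)\<close> down to the
  optimal value.

  Feasibility comes from an invariant of the execution (\<open>cut_invariant\<close>): the incumbent is either
  the artificial starting point, whose objective is \<open>U\<close>, or a point at which the search found no
  violated constraint.  As \<open>U\<close> lies strictly above the optimal value, the objective bound excludes
  the starting point.
\<close>

text \<open>
  The Slater slack \<open>\<eta>\<close> passes linearly, by convexity, to the segment from a feasible point to the
  Slater point, with the same constant for every index.
\<close>

lemma slater_segment_point:
  fixes X E :: "'a::real_vector set" and g :: "'a \<Rightarrow> 't \<Rightarrow> real"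
  assumes "convex X" "X \<subseteq> E" "\<And>r. r \<in> T \<Longrightarrow> convex_on E (\<lambda>z. g z r)"
    and "xbar \<in> X" "\<And>r. r \<in> T \<Longrightarrow> g xbar r \<le> - \<eta>"
    and "p \<in> X" "\<And>r. r \<in> T \<Longrightarrow> g p r \<le> 0"
    and "0 \<le> l" "l \<le> 1"
  shows "(1 - l) *\<^sub>R p + l *\<^sub>R xbar \<in> X"
    and "r \<in> T \<Longrightarrow> g ((1 - l) *\<^sub>R p + l *\<^sub>R xbar) r \<le> - (l * \<eta>)"
proof -
  show "(1 - l) *\<^sub>R p + l *\<^sub>R xbar \<in> X"
    using convexD_alt[OF assms(1,6,4,8,9)] .
next
  assume r: "r \<in> T"
  have "g ((1 - l) *\<^sub>R p + l *\<^sub>R xbar) r \<le> (1 - l) * g p r + l * g xbar r"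
    using convex_onD[OF assms(3)[OF r] assms(8,9)] assms(2,4,6) by blast
  also have "\<dots> \<le> (1 - l) * 0 + l * (- \<eta>)"
    using assms(5)[OF r] assms(7)[OF r] assms(8,9) by (intro add_mono mult_left_mono) auto
  finally show "g ((1 - l) *\<^sub>R p + l *\<^sub>R xbar) r \<le> - (l * \<eta>)" by simp
qed

text \<open>
  For \<open>\<tau> > 0\<close> the term \<open>\<tau> * s j\<close> is at most \<open>\<tau> * B\<close>, so one \<open>\<tau>\<close> small against the uniform
  slack of a point on the segment satisfies all cuts at once.
\<close>

lemma positive_master_value:
  fixes o1 :: "'n::finite" and p :: "real ^ 'n"
  assumes a1: "assumption1 E X T g B"
    and p: "p \<in> X" "\<And>r. r \<in> T \<Longrightarrow> g p r \<le> 0" "p $ o1 < v"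
    and cuts: "\<And>j. j \<in> J \<Longrightarrow> t j \<in> T \<and> s j \<le> B"
    and opt: "master_optimal o1 X g t s v J z \<sigma>"
  shows "0 < \<sigma>"
proof -
  from a1 obtain xbar \<eta> where sl: "xbar \<in> X" "\<eta> > 0" "\<And>r. r \<in> T \<Longrightarrow> g xbar r \<le> - \<eta>"
    and B: "B > 0" and cvx: "convex X" "X \<subseteq> E" "\<And>r. r \<in> T \<Longrightarrow> convex_on E (\<lambda>z. g z r)"
    unfolding assumption1_def by blast
  define a where "a = \<bar>xbar $ o1 - p $ o1\<bar> + 1"
  define l where "l = min 1 ((v - p $ o1) / (2 * a))"
  define w where "w = (1 - l) *\<^sub>R p + l *\<^sub>R xbar"
  define \<tau> where "\<tau> = min ((v - p $ o1) / 2) (l * \<eta> / B)"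
  have a: "a > 0" unfolding a_def by linarith
  have l: "0 < l" "l \<le> 1" using p(3) a by (auto simp: l_def)
  have wX: "w \<in> X" and wg: "\<And>r. r \<in> T \<Longrightarrow> g w r \<le> - (l * \<eta>)"
    using slater_segment_point[OF cvx sl(1,3) p(1,2), where l = l] l unfolding w_def by auto
  have \<tau>: "0 < \<tau>" using p(3) l(1) sl(2) B by (simp add: \<tau>_def)
  \<comment> \<open>Half of the gap \<open>v - p $ o1\<close> pays for the move to \<open>w\<close>, the other half for \<open>\<tau>\<close>.\<close>
  have "w $ o1 = p $ o1 + l * (xbar $ o1 - p $ o1)"
    by (simp add: w_def algebra_simps)
  moreover have "l * (xbar $ o1 - p $ o1) \<le> l * a"
    using l(1) by (intro mult_left_mono) (auto simp: a_def)
  moreover have "l * a \<le> (v - p $ o1) / (2 * a) * a"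
    using a by (intro mult_right_mono) (auto simp: l_def)
  moreover have "(v - p $ o1) / (2 * a) * a = (v - p $ o1) / 2" using a by simp
  moreover have "\<tau> \<le> (v - p $ o1) / 2" unfolding \<tau>_def by (rule min.cobounded1)
  ultimately have obj: "w $ o1 + \<tau> \<le> v" by argo
  have "g w (t j) + \<tau> * s j \<le> 0" if j: "j \<in> J" for j
  proof -
    have "\<tau> * s j \<le> \<tau> * B" using cuts[OF j] \<tau> by (intro mult_left_mono) auto
    also have "\<dots> \<le> l * \<eta> / B * B" using B by (intro mult_right_mono) (auto simp: \<tau>_def)
    also have "\<dots> = l * \<eta>" using B by simp
    finally show ?thesis using wg[of "t j"] cuts[OF j] by linarith
  qed
  with obj wX opt have "\<tau> \<le> \<sigma>"
    unfolding master_optimal_def is_arg_max_linorder by fastforce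
  with \<tau> show ?thesis by simp
qed

text \<open>
  Under the subgradient strategy the bound holds because \<open>B\<close> bounds every subgradient
  at points of \<open>X\<close> and the factor \<open>\<alpha>\<close> is at most 1.
\<close>

lemma centering_parameter_le:
  assumes "assumption1 E X T g B" "x \<in> X" "r \<in> T" "centering_parameter E g B c x r s"
  shows "s \<le> B"
proof (cases c)
  case (Interval smin)
  with assms(4) show ?thesis by simp
next
  case Subgradient
  with assms(4) obtain \<alpha> d where d: "0 < \<alpha>" "\<alpha> \<le> 1"
    "d \<in> subdifferential E (\<lambda>z. g z r) x" "s = \<alpha> * norm d" by auto
  have "s \<le> norm d" using d by (simp add: mult_left_le_one_le)
  also have "norm d \<le> B" using assms(1-3) d(3) unfolding assumption1_def by blast
  finally show ?thesis .
qed

text \<open>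
  Dropping cuts only shrinks \<open>J i\<close>, which preserves the claim about the cuts; together with
  \<open>centering_parameter_le\<close> it supplies the bounds needed for \<open>positive_master_value\<close>.
\<close>

lemma cut_invariant:
  assumes a1: "assumption1 E X T g B" and a2: "assumption2 X T g \<epsilon> search"
    and run: "terminates_in o1 E X g U B search c \<beta> x \<sigma> y J t s k"
    and "i < k"
  shows "(y i = axis o1 U \<or> eps_feasible X T g \<epsilon> (y i)) \<and> (\<forall>j\<in>J i. t j \<in> T \<and> s j \<le> B)"
  using \<open>i < k\<close>
proof (induction i)
  case 0
  with run show ?case by (simp add: terminates_in_def)
next
  case (Suc i)
  have IH: "y i = axis o1 U \<or> eps_feasible X T g \<epsilon> (y i)" "\<forall>j\<in>J i. t j \<in> T \<and> s j \<le> B"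
    using Suc by auto
  have i: "Suc i \<in> {1..k}" "Suc i \<in> {1..<k}" using Suc.prems by auto
  have "master_optimal o1 X g t s (y (Suc i - 1) $ o1) (J (Suc i - 1)) (x (Suc i)) (\<sigma> (Suc i))"
    using run i(1) unfolding terminates_in_def by blast
  then have X: "x (Suc i) \<in> X"
    unfolding master_optimal_def is_arg_max_def by simp
  from run i(2) consider
    (feas) "feasibility_cut E g B search c \<beta> x \<sigma> y J t s (Suc i)"
    | (opt) "optimality_cut g search \<beta> x \<sigma> y J t s (Suc i)"
    unfolding terminates_in_def by blast
  then show ?case
  proof cases
    case feas
    then have *: "Some (t (Suc i)) \<in> search (x (Suc i))" "y (Suc i) = y i"
      "centering_parameter E g B c (x (Suc i)) (t (Suc i)) (s (Suc i))"
      "J (Suc i) \<subseteq> J i \<union> {Suc i}"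
      unfolding feasibility_cut_def Let_def by auto
    have T: "t (Suc i) \<in> T" using a2 X *(1) unfolding assumption2_def by blast
    with centering_parameter_le[OF a1 X T *(3)] * IH show ?thesis by auto
  next
    case opt
    then have *: "None \<in> search (x (Suc i))" "y (Suc i) = x (Suc i)" "J (Suc i) \<subseteq> J i"
      unfolding optimality_cut_def Let_def by auto
    with a2 X have "eps_feasible X T g \<epsilon> (y (Suc i))" unfolding assumption2_def by metis
    with *(3) IH(2) show ?thesis by blast
  qed
qed

theorem theorem2:
  fixes o1 :: "'n::finite" and E X :: "(real ^ 'n) set" and T :: "'t set"
    and g :: "real ^ 'n \<Rightarrow> 't \<Rightarrow> real" and U B \<epsilon> :: real and \<beta> :: ereal
    and search :: "real ^ 'n \<Rightarrow> 't option set" and c :: centering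
    and xopt :: "real ^ 'n"
    and x y :: "nat \<Rightarrow> real ^ 'n" and \<sigma> s :: "nat \<Rightarrow> real"
    and J :: "nat \<Rightarrow> nat set" and t :: "nat \<Rightarrow> 't" and k :: nat
  assumes "assumption1 E X T g B"
    and "\<epsilon> \<ge> 0"
    and "assumption2 X T g \<epsilon> search"
    and "sicp_optimal o1 X T g xopt"
    and "xopt $ o1 < U"
    and "1 < \<beta>"
    and "valid_centering c"
    and "terminates_in o1 E X g U B search c \<beta> x \<sigma> y J t s k"
  shows "eps_optimal o1 X T g \<epsilon> xopt (y (k - 1))"
proof -
  have k: "k \<ge> 1" "\<sigma> k = 0"
    using assms(8) by (auto simp: terminates_in_def)
  then have "k \<in> {1..k}" by simp
  then have opt: "master_optimal o1 X g t s (y (k - 1) $ o1) (J (k - 1)) (x k) (\<sigma> k)"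
    using assms(8) unfolding terminates_in_def by blast
  have inv: "y (k - 1) = axis o1 U \<or> eps_feasible X T g \<epsilon> (y (k - 1))"
    "\<And>j. j \<in> J (k - 1) \<Longrightarrow> t j \<in> T \<and> s j \<le> B"
    using cut_invariant[OF assms(1,3,8), of "k - 1"] k(1) by auto
  have p: "xopt \<in> X" "\<And>r. r \<in> T \<Longrightarrow> g xopt r \<le> 0"
    using assms(4) unfolding sicp_optimal_def is_arg_min_def by auto
  have le: "y (k - 1) $ o1 \<le> xopt $ o1"
  proof (rule ccontr)
    assume "\<not> ?thesis"
    then have "0 < \<sigma> k"
      by (intro positive_master_value[OF assms(1) p _ inv(2) opt]) auto
    with k(2) show False by simp
  qed
  with assms(5) have "y (k - 1) \<noteq> axis o1 U" by auto
  with inv(1) le show ?thesis unfolding eps_optimal_def by blast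
qed

end
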